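(* Let $f\in L^2(\Omega)$ and assume that the characteristic functions $\chi_\epsilon$ of $\Omega^\epsilon$ satisfy $\chi_\epsilon\rightharpoonup\mathcal{X}$ weakly$^*$ in $L^\infty(\Omega)$ as $\epsilon\to0$. Let $\{u^\epsilon\}_{\epsilon>0}$ be the family of solutions of the nonlocal Dirichlet problem $$f(x)=\int_{\mathbb{R}^N}J(x-y)\,(u^\epsilon(y)-u^\epsilon(x))\,dy,\quad x\in\Omega^\epsilon,\qquad u^\epsilon(x)\equiv0,\quad x\in\mathbb{R}^N\setminus\Omega^\epsilon.$$ Then there exists $u^*\in L^2(\Omega)$ such that $\tilde u^\epsilon\rightharpoonup u^*$ weakly in $L^2(\Omega)$ as $\epsilon\to0$. Moreover, $u^*$ satisfies the following nonlocal problem in $\Omega$: $$\mathcal{X}(x)f(x)=\mathcal{X}(x)\int_{\mathbb{R}^N}J(x-y)\,(u^*(y)-u^*(x))\,dy-(1-\mathcal{X}(x))\,u^*(x)\quad\text{for a.e. }x\in\Omega,$$ with $u^*(x)\equiv0$ for $x\in\mathbb{R}^N\setminus\Omega$.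
   Context: $\Omega\subset\mathbb{R}^N$ is a fixed open bounded domain and $\{\Omega^\epsilon\}_{\epsilon>0}$ is a family of open bounded sets with $\Omega^\epsilon\subset\Omega$. $\chi_\epsilon$ is the characteristic function of $\Omega^\epsilon$. $\mathcal{X}\in L^\infty(\mathbb{R}^N)$ satisfies $0\le\mathcal{X}\le1$ and $\mathcal{X}=0$ in $\mathbb{R}^N\setminus\Omega$. Weak$^*$ convergence means $\int_\Omega\chi_\epsilon\varphi\,dx\to\int_\Omega\mathcal{X}\varphi\,dx$ for all $\varphi\in L^1(\Omega)$. The kernel $J\in\mathcal{C}(\mathbb{R}^N,\mathbb{R})$ is non-negative, compactly supported, $J(0)>0$, $J(-x)=J(x)$ for all $x$, and $\int_{\mathbb{R}^N}J(x)\,dx=1$. Solutions $u^\epsilon$ are $L^2$ functions vanishing outside $\Omega^\epsilon$ that satisfy the equation a.e. in $\Omega^\epsilon$. The tilde denotes extension by zero of functions defined on subsets of $\mathbb{R}^N$. *)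

theory Defs
  imports "HOL-Analysis.Analysis"
begin

text \<open>
  Elements of Lebesgue spaces are represented by measurable functions; membership in the
  corresponding \<open>L\<^sup>1\<close> space is \<^const>\<open>integrable\<close>.
\<close>

definition L2 :: "'a measure \<Rightarrow> ('a \<Rightarrow> real) \<Rightarrow> bool" where
  "L2 M g \<longleftrightarrow> g \<in> borel_measurable M \<and> integrable M (\<lambda>x. (g x)\<^sup>2)"

definition L_infty :: "'a measure \<Rightarrow> ('a \<Rightarrow> real) \<Rightarrow> bool" where
  "L_infty M g \<longleftrightarrow> g \<in> borel_measurable M \<and> (\<exists>C. AE x in M. \<bar>g x\<bar> \<le> C)"

definition weakly_star_tendsto_L_infty ::
    "'a measure \<Rightarrow> ('b \<Rightarrow> 'a \<Rightarrow> real) \<Rightarrow> ('a \<Rightarrow> real) \<Rightarrow> 'b filter \<Rightarrow> bool" where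
  "weakly_star_tendsto_L_infty M g g0 F \<longleftrightarrow>
     (\<forall>\<phi>. integrable M \<phi> \<longrightarrow>
       ((\<lambda>e. \<integral>x. g e x * \<phi> x \<partial>M) \<longlongrightarrow> (\<integral>x. g0 x * \<phi> x \<partial>M)) F)"

definition weakly_tendsto_L2 ::
    "'a measure \<Rightarrow> ('b \<Rightarrow> 'a \<Rightarrow> real) \<Rightarrow> ('a \<Rightarrow> real) \<Rightarrow> 'b filter \<Rightarrow> bool" where
  "weakly_tendsto_L2 M g g0 F \<longleftrightarrow>
     (\<forall>\<phi>. L2 M \<phi> \<longrightarrow>
       ((\<lambda>e. \<integral>x. g e x * \<phi> x \<partial>M) \<longlongrightarrow> (\<integral>x. g0 x * \<phi> x \<partial>M)) F)"

definition zero_ext :: "'a set \<Rightarrow> ('a \<Rightarrow> real) \<Rightarrow> 'a \<Rightarrow> real" where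
  "zero_ext S g = (\<lambda>x. if x \<in> S then g x else 0)"

definition nonlocal_op ::
    "(real ^ 'n \<Rightarrow> real) \<Rightarrow> (real ^ 'n \<Rightarrow> real) \<Rightarrow> real ^ 'n \<Rightarrow> real" where
  "nonlocal_op J u x = (\<integral>y. J (x - y) * (u y - u x) \<partial>lebesgue)"

definition nonlocal_dirichlet_solution ::
    "(real ^ 'n \<Rightarrow> real) \<Rightarrow> (real ^ 'n \<Rightarrow> real) \<Rightarrow> (real ^ 'n) set \<Rightarrow> (real ^ 'n \<Rightarrow> real) \<Rightarrow> bool" where
  "nonlocal_dirichlet_solution J f S u \<longleftrightarrow>
     L2 lebesgue u \<and>
     (AE x in lebesgue. x \<in> S \<longrightarrow> f x = nonlocal_op J u x) \<and>
     (AE x in lebesgue. x \<notin> S \<longrightarrow> u x = 0)"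

end

(*
  With \<integral>J = 1 the equation reads u\<^sup>\<epsilon> = \<chi>\<^sub>\<epsilon> (w\<^sup>\<epsilon> - f) where w\<^sup>\<epsilon> = J * u\<^sup>\<epsilon>.
  Since J is symmetric, J * (A - |x|\<^sup>2) = A - |x|\<^sup>2 - c with c > 0 the second moment of J, so a
  truncated paraboloid \<psi> satisfies J * (1\<^sub>\<Omega> \<psi>) \<le> \<theta> \<psi> with \<theta> < 1. Hence w \<mapsto> J * (X (w - f)) is a
  contraction in the sup norm weighted by \<psi>; let w be its fixed point and u\<^sup>* = X (w - f).
  The difference d = w\<^sup>\<epsilon> - w satisfies d = J * (\<chi>\<^sub>\<epsilon> d) + J * ((\<chi>\<^sub>\<epsilon> - X) (w - f)), and the last term
  tends to 0 uniformly on \<Omega>, by weak* convergence at each point and equicontinuity. The weighted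
  estimate then gives d \<rightarrow> 0 uniformly, so that u\<^sup>\<epsilon> = \<chi>\<^sub>\<epsilon> d + \<chi>\<^sub>\<epsilon> (w - f) converges weakly to u\<^sup>*.
*)
theory Submission
  imports Defs
begin

section \<open>General facts: reflected translates, uniform convergence, square-integrable
  functions\<close>

lemma lborel_integral_reflect_shift:
  fixes g :: "'a::euclidean_space \<Rightarrow> real"
  assumes [measurable]: "g \<in> borel_measurable borel"
  shows "(\<integral>y. g (x - y) \<partial>lborel) = (\<integral>y. g y \<partial>lborel)"
    and "integrable lborel (\<lambda>y. g (x - y)) \<longleftrightarrow> integrable lborel g"
proof -
  have *: "(lborel :: 'a measure) = distr lborel borel (\<lambda>y. x - y)"
    using lborel_affine[of "-1" x] by (simp add: density_1)
  show "(\<integral>y. g (x - y) \<partial>lborel) = (\<integral>y. g y \<partial>lborel)"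
    by (subst (2) *) (simp add: integral_distr)
  show "integrable lborel (\<lambda>y. g (x - y)) \<longleftrightarrow> integrable lborel g"
    by (subst (2) *) (simp add: integrable_distr_eq)
qed

text \<open>A finite \<open>\<delta>\<close>-net of the compact closure reduces the claim to
  finitely many pointwise limits; equicontinuity carries the bound from a net point to all points
  near it, each contributing \<open>\<eta> / 2\<close>. Equicontinuity is asked for only eventually
  along \<open>F\<close>, since the families in question are controlled only for positive
  parameters.\<close>

lemma tendsto_uniform_on_bounded:
  fixes r :: "'b \<Rightarrow> 'a::euclidean_space \<Rightarrow> real"
  assumes S: "bounded S"
    and lim: "\<And>x. ((\<lambda>\<epsilon>. r \<epsilon> x) \<longlongrightarrow> 0) F"
    and equicont: "\<And>\<eta>. \<eta> > 0 \<Longrightarrow> \<exists>\<delta>>0. \<forall>\<^sub>F \<epsilon> in F. \<forall>x y. dist x y < \<delta> \<longrightarrow> \<bar>r \<epsilon> x - r \<epsilon> y\<bar> \<le> \<eta>"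
    and "\<eta> > 0"
  shows "\<forall>\<^sub>F \<epsilon> in F. \<forall>x\<in>S. \<bar>r \<epsilon> x\<bar> \<le> \<eta>"
proof -
  obtain \<delta> where \<delta>: "\<delta> > 0"
    "\<forall>\<^sub>F \<epsilon> in F. \<forall>x y. dist x y < \<delta> \<longrightarrow> \<bar>r \<epsilon> x - r \<epsilon> y\<bar> \<le> \<eta> / 2"
    using equicont[of "\<eta> / 2"] \<open>\<eta> > 0\<close> by auto
  have "compact (closure S)"
    using S by (simp add: compact_closure)
  then obtain T where T: "finite T" "closure S \<subseteq> (\<Union>x\<in>T. ball x \<delta>)"
    using \<delta>(1) unfolding compact_eq_totally_bounded by blast
  have "\<forall>\<^sub>F \<epsilon> in F. \<forall>x\<in>T. \<bar>r \<epsilon> x\<bar> < \<eta> / 2"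
    using T(1)
  proof (rule eventually_ball_finite, intro ballI)
    fix x
    show "\<forall>\<^sub>F \<epsilon> in F. \<bar>r \<epsilon> x\<bar> < \<eta> / 2"
      using tendstoD[OF lim[of x], of "\<eta> / 2"] \<open>\<eta> > 0\<close> by simp
  qed
  with \<delta>(2) show ?thesis
  proof eventually_elim
    case (elim \<epsilon>)
    show ?case
    proof
      fix x assume "x \<in> S"
      then obtain z where "z \<in> T" "dist z x < \<delta>"
        using T(2) closure_subset[of S] by auto
      then have "\<bar>r \<epsilon> z - r \<epsilon> x\<bar> \<le> \<eta> / 2" "\<bar>r \<epsilon> z\<bar> < \<eta> / 2"
        using elim by auto
      then show "\<bar>r \<epsilon> x\<bar> \<le> \<eta>"
        by linarith
    qed
  qed
qed

lemma L2_mult_integrable: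
  assumes "L2 M g" "L2 M h"
  shows "integrable M (\<lambda>x. g x * h x)"
proof (rule Bochner_Integration.integrable_bound)
  have [measurable]: "g \<in> borel_measurable M" "h \<in> borel_measurable M"
    using assms by (auto simp: L2_def)
  show "integrable M (\<lambda>x. (g x)\<^sup>2 + (h x)\<^sup>2)"
    using assms by (auto simp: L2_def)
  show "(\<lambda>x. g x * h x) \<in> borel_measurable M"
    by measurable
  have "\<bar>a * b\<bar> \<le> a\<^sup>2 + b\<^sup>2" for a b :: real
    using sum_squares_bound[of "\<bar>a\<bar>" "\<bar>b\<bar>"] abs_ge_zero[of "a * b"]
    unfolding abs_mult power2_abs by linarith
  then show "AE x in M. norm (g x * h x) \<le> norm ((g x)\<^sup>2 + (h x)\<^sup>2)"
    by simp
qed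

lemma L2_bounded_mult:
  assumes "L2 M g" and [measurable]: "h \<in> borel_measurable M" and "AE x in M. \<bar>h x\<bar> \<le> C"
  shows "L2 M (\<lambda>x. h x * g x)"
proof -
  have [measurable]: "g \<in> borel_measurable M"
    using assms by (auto simp: L2_def)
  have "integrable M (\<lambda>x. (h x * g x)\<^sup>2)"
  proof (rule Bochner_Integration.integrable_bound)
    show "integrable M (\<lambda>x. C\<^sup>2 * (g x)\<^sup>2)"
      using assms by (auto simp: L2_def)
    show "AE x in M. norm ((h x * g x)\<^sup>2) \<le> norm (C\<^sup>2 * (g x)\<^sup>2)"
      using assms(3)
    proof eventually_elim
      case (elim x)
      then have "(h x)\<^sup>2 \<le> C\<^sup>2"
        by (metis abs_ge_zero power2_abs power_mono)
      then show ?case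
        by (simp add: power_mult_distrib mult_right_mono)
    qed
  qed measurable
  then show ?thesis
    by (simp add: L2_def)
qed

lemma integrable_bounded_mult:
  fixes g h :: "'b \<Rightarrow> real"
  assumes g: "integrable N g" and [measurable]: "h \<in> borel_measurable N" and bd: "AE x in N. \<bar>h x\<bar> \<le> C"
  shows "integrable N (\<lambda>x. h x * g x)"
proof (rule Bochner_Integration.integrable_bound)
  show "integrable N (\<lambda>x. C * g x)"
    using g by simp
  show "AE x in N. norm (h x * g x) \<le> norm (C * g x)"
    using bd
  proof eventually_elim
    case (elim x)
    then have "\<bar>h x\<bar> \<le> \<bar>C\<bar>"
      by linarith
    then show ?case
      by (simp add: abs_mult mult_right_mono)
  qed
qed (use g in measurable)

section \<open>The kernel: support, uniform continuity and boundedness\<close>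

locale dispersal_kernel =
  fixes \<Omega> :: "'a::euclidean_space set" and J :: "'a \<Rightarrow> real"
  assumes bounded_dom: "bounded \<Omega>" and sets_dom: "\<Omega> \<in> sets lebesgue"
    and cont_J: "continuous_on UNIV J" and J_nonneg: "\<And>x. J x \<ge> 0"
    and supp_J: "compact (closure {x. J x \<noteq> 0})" and J_0: "J 0 > 0"
    and J_sym: "\<And>x. J (- x) = J x" and integral_J_lebesgue: "(\<integral>x. J x \<partial>lebesgue) = 1"
begin

abbreviation M where "M \<equiv> lebesgue_on \<Omega>"

text \<open>This is the convolution of \<open>J\<close> with the extension of \<open>g\<close> by
  zero outside \<open>\<Omega>\<close>. It is evaluated at every point of the space, not only on
  \<open>\<Omega>\<close>.\<close>

abbreviation conv :: "('a \<Rightarrow> real) \<Rightarrow> 'a \<Rightarrow> real" where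
  "conv g x \<equiv> (\<integral>y. J (x - y) * g y \<partial>M)"

lemma J_borel [measurable]: "J \<in> borel_measurable borel"
  using cont_J by (rule borel_measurable_continuous_onI)

lemma borel_imp_M [measurable (raw)]:
  fixes g :: "'a \<Rightarrow> real"
  assumes "g \<in> borel_measurable borel"
  shows "g \<in> borel_measurable M"
  using assms by (intro measurable_restrict_space1 measurable_completion) simp

lemma J_shift_M: "(\<lambda>y. J (x - y)) \<in> borel_measurable M"
  by (rule borel_imp_M) measurable

lemma finite_measure_M: "finite_measure M"
  using bounded_dom sets_dom
  by (intro finite_measure_lebesgue_on) (simp add: bounded_set_imp_lmeasurable)

lemma supp_bound:
  obtains B where "B > 0" "\<And>z. norm z \<ge> B \<Longrightarrow> J z = 0"
proof -
  have "bounded {x. J x \<noteq> 0}"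
    using supp_J compact_imp_bounded bounded_subset closure_subset by metis
  then obtain B where "B > 0" "\<forall>x\<in>{x. J x \<noteq> 0}. norm x < B"
    using bounded_pos_less by metis
  then show ?thesis
    using that[of B] by force
qed

text \<open>Heine-Cantor on a ball, with a margin of 1 around the support: two points closer than 1
  either both lie in the ball of radius \<open>B + 1\<close>, or both have norm at least
  \<open>B\<close>, where \<open>J\<close> vanishes.\<close>

lemma J_uniformly_continuous: "uniformly_continuous_on UNIV J"
proof -
  obtain B where B: "B > 0" "\<And>z. norm z \<ge> B \<Longrightarrow> J z = 0"
    using supp_bound by blast
  have "uniformly_continuous_on (cball 0 (B + 1)) J"
    using cont_J continuous_on_subset by (intro compact_uniformly_continuous) auto
  show ?thesis
    unfolding uniformly_continuous_on_def
  proof (intro allI impI)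
    fix e :: real assume "e > 0"
    with \<open>uniformly_continuous_on (cball 0 (B + 1)) J\<close> obtain d where d: "d > 0"
      "\<And>x y. x \<in> cball 0 (B + 1) \<Longrightarrow> y \<in> cball 0 (B + 1) \<Longrightarrow> dist y x < d \<Longrightarrow> dist (J y) (J x) < e"
      unfolding uniformly_continuous_on_def by metis
    have "dist (J y) (J x) < e" if "dist y x < min d 1" for x y
    proof (cases "x \<in> cball 0 (B + 1) \<and> y \<in> cball 0 (B + 1)")
      case True
      then show ?thesis
        using d that by auto
    next
      case False
      have "\<bar>norm y - norm x\<bar> < 1"
        using that norm_triangle_ineq3[of y x] by (simp add: dist_norm)
      with False have "norm x \<ge> B" "norm y \<ge> B"
        by auto
      then show ?thesis
        using B \<open>e > 0\<close> by simp
    qed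
    then show "\<exists>d>0. \<forall>x\<in>UNIV. \<forall>x'\<in>UNIV. dist x' x < d \<longrightarrow> dist (J x') (J x) < e"
      using d(1) by (intro exI[of _ "min d 1"]) auto
  qed
qed

lemma J_bounded:
  obtains C where "C > 0" "\<And>z. \<bar>J z\<bar> \<le> C"
proof -
  obtain B where B: "B > 0" "\<And>z. norm z \<ge> B \<Longrightarrow> J z = 0"
    using supp_bound by blast
  have "bounded (J ` cball 0 B)"
    using cont_J continuous_on_subset by (intro compact_imp_bounded compact_continuous_image) auto
  then obtain C where C: "C > 0" "\<And>z. z \<in> cball 0 B \<Longrightarrow> \<bar>J z\<bar> \<le> C"
    unfolding bounded_pos by auto
  have "\<bar>J z\<bar> \<le> C" for z
    using C B(2)[of z] by (cases "norm z \<le> B") auto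
  then show ?thesis
    using that C(1) by blast
qed

section \<open>Mass and moments of the kernel\<close>

lemma integral_J: "(\<integral>z. J z \<partial>lborel) = 1"
  using integral_J_lebesgue integral_completion[of J lborel] by simp

text \<open>The integral of a non-integrable function is 0 by convention, so the value 1 forces
  integrability.\<close>

lemma integrable_J: "integrable lborel J"
  using integral_J not_integrable_integral_eq by fastforce

text \<open>Only the values of \<open>p\<close> on a ball containing the support of \<open>J\<close>
  matter, and there a multiple of \<open>J\<close> dominates the product. This serves the polynomial
  weights below.\<close>

lemma integrable_J_mult:
  assumes [measurable]: "p \<in> borel_measurable borel"
    and bd: "\<And>B. \<exists>C. \<forall>z. norm z \<le> B \<longrightarrow> \<bar>p z\<bar> \<le> C"
  shows "integrable lborel (\<lambda>z. J z * p z)"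
proof -
  obtain B where B: "B > 0" "\<And>z. norm z \<ge> B \<Longrightarrow> J z = 0"
    using supp_bound by blast
  obtain C where C: "\<And>z. norm z \<le> B \<Longrightarrow> \<bar>p z\<bar> \<le> C"
    using bd by metis
  show ?thesis
  proof (rule Bochner_Integration.integrable_bound)
    show "integrable lborel (\<lambda>z. C * J z)"
      using integrable_J by simp
    have "\<bar>J z * p z\<bar> \<le> \<bar>C * J z\<bar>" for z
    proof (cases "norm z \<le> B")
      case True
      have "J z * \<bar>p z\<bar> \<le> J z * C"
        using C[OF True] J_nonneg by (rule mult_left_mono)
      also have "\<dots> \<le> \<bar>C * J z\<bar>"
        by (simp add: mult.commute)
      finally show ?thesis
        using J_nonneg[of z] by (simp add: abs_mult)
    qed (use B in simp)
    then show "AE z in lborel. norm (J z * p z) \<le> norm (C * J z)"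
      by simp
  qed measurable
qed

lemma integrable_J_inner: "integrable lborel (\<lambda>z. J z * (a \<bullet> z))"
proof (rule integrable_J_mult)
  show "\<exists>C. \<forall>z. norm z \<le> B \<longrightarrow> \<bar>a \<bullet> z\<bar> \<le> C" for B
    by (intro exI[of _ "norm a * B"])
       (metis Cauchy_Schwarz_ineq2 mult_left_mono norm_ge_zero order_trans)
qed measurable

lemma integrable_J_square: "integrable lborel (\<lambda>z. J z * (norm z)\<^sup>2)"
proof (rule integrable_J_mult)
  show "\<exists>C. \<forall>z. norm z \<le> B \<longrightarrow> \<bar>(norm z)\<^sup>2\<bar> \<le> C" for B
    by (intro exI[of _ "B\<^sup>2"]) (simp add: power_mono)
qed measurable

text \<open>By the symmetry of \<open>J\<close>, the reflection \<open>z \<mapsto> - z\<close> turns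
  the integral into its own negative.\<close>

lemma first_moment: "(\<integral>z. J z * (a \<bullet> z) \<partial>lborel) = 0"
  using lborel_integral_reflect_shift(1)[of "\<lambda>z. J z * (a \<bullet> z)" 0] J_sym by simp

text \<open>Were it zero, \<open>J\<close> would vanish almost everywhere away from the origin; but
  the set where \<open>J\<close> is nonzero is open and contains the origin, so it is not
  negligible.\<close>

lemma second_moment_pos: "(\<integral>z. J z * (norm z)\<^sup>2 \<partial>lborel) > 0"
proof -
  have "(\<integral>z. J z * (norm z)\<^sup>2 \<partial>lborel) \<noteq> 0"
  proof
    assume "(\<integral>z. J z * (norm z)\<^sup>2 \<partial>lborel) = 0"
    then have "AE z in lborel. J z * (norm z)\<^sup>2 = 0"
      using integral_nonneg_eq_0_iff_AE[OF integrable_J_square] J_nonneg by simp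
    then have "AE z in lebesgue. J z * (norm z)\<^sup>2 = 0"
      by (rule AE_completion)
    then have "negligible {z. J z * (norm z)\<^sup>2 \<noteq> 0}"
      unfolding eventually_ae_filter_negligible by (meson mem_Collect_eq negligible_subset subset_eq)
    \<comment> \<open>The weight vanishes at the origin although \<open>J 0 > 0\<close>; adding this
      single point recovers the open set where \<open>J\<close> is nonzero.\<close>
    then have neg: "negligible (insert 0 {z. J z * (norm z)\<^sup>2 \<noteq> 0})"
      by simp
    have "insert 0 {z. J z * (norm z)\<^sup>2 \<noteq> 0} = {z. J z \<noteq> 0}"
      using J_0 by auto
    moreover have "open {z. J z \<noteq> 0}"
      using open_Collect_neq[OF cont_J] by simp
    ultimately show False
      using neg open_not_negligible J_0 by force
  qed
  moreover have "(\<integral>z. J z * (norm z)\<^sup>2 \<partial>lborel) \<ge> 0"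
    using J_nonneg by simp
  ultimately show ?thesis
    by linarith
qed

text \<open>Substitute \<open>z = x - y\<close> and expand the square: the constant part is
  reproduced because \<open>J\<close> has mass 1, the linear part drops out by symmetry, and the
  quadratic part leaves the second moment. Convolution thus lowers a paraboloid by a fixed positive
  amount.\<close>

lemma J_convolve_paraboloid:
  "(\<integral>y. J (x - y) * (A - (norm y)\<^sup>2) \<partial>lborel) = A - (norm x)\<^sup>2 - (\<integral>z. J z * (norm z)\<^sup>2 \<partial>lborel)"
  and integrable_J_paraboloid: "integrable lborel (\<lambda>y. J (x - y) * (A - (norm y)\<^sup>2))"
proof -
  have eq: "J z * (A - (norm (x - z))\<^sup>2) =
      (A - (norm x)\<^sup>2) * J z + 2 * (J z * (x \<bullet> z)) - J z * (norm z)\<^sup>2" for z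
    unfolding power2_norm_eq_inner
    by (simp add: inner_diff_left inner_diff_right inner_commute algebra_simps)
  let ?g = "\<lambda>z. J z * (A - (norm (x - z))\<^sup>2)"
  have g: "?g \<in> borel_measurable borel"
    by measurable
  have int: "integrable lborel ?g"
    unfolding eq using integrable_J integrable_J_inner[of x] integrable_J_square by simp
  have "(\<integral>y. J (x - y) * (A - (norm y)\<^sup>2) \<partial>lborel) = (\<integral>z. ?g z \<partial>lborel)"
    using lborel_integral_reflect_shift(1)[OF g, of x] by simp
  also have "\<dots> = A - (norm x)\<^sup>2 - (\<integral>z. J z * (norm z)\<^sup>2 \<partial>lborel)"
    unfolding eq using integrable_J integrable_J_inner[of x] integrable_J_square
    by (simp add: integral_J first_moment)
  finally show "(\<integral>y. J (x - y) * (A - (norm y)\<^sup>2) \<partial>lborel) =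
    A - (norm x)\<^sup>2 - (\<integral>z. J z * (norm z)\<^sup>2 \<partial>lborel)" .
  show "integrable lborel (\<lambda>y. J (x - y) * (A - (norm y)\<^sup>2))"
    using lborel_integral_reflect_shift(2)[OF g, of x] int by simp
qed

section \<open>Bounds and equicontinuity for convolution over the domain\<close>

lemma integrable_conv:
  assumes "integrable M g"
  shows "integrable M (\<lambda>y. J (x - y) * g y)"
proof -
  obtain C where "\<And>z. \<bar>J z\<bar> \<le> C"
    using J_bounded by metis
  then show ?thesis
    using assms J_shift_M by (intro integrable_bounded_mult[where C = C]) auto
qed

lemma conv_bounded:
  obtains C where "C > 0" "\<And>g x. integrable M g \<Longrightarrow> \<bar>conv g x\<bar> \<le> C * (\<integral>y. \<bar>g y\<bar> \<partial>M)"
proof -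
  obtain C where C: "C > 0" "\<And>z. \<bar>J z\<bar> \<le> C"
    using J_bounded by metis
  have "\<bar>conv g x\<bar> \<le> C * (\<integral>y. \<bar>g y\<bar> \<partial>M)" if g: "integrable M g" for g x
  proof -
    have "\<bar>conv g x\<bar> \<le> (\<integral>y. \<bar>J (x - y) * g y\<bar> \<partial>M)"
      by (rule integral_abs_bound)
    also have "\<dots> \<le> (\<integral>y. C * \<bar>g y\<bar> \<partial>M)"
      using integrable_abs[OF integrable_conv[OF g, of x]] integrable_abs[OF g] C(2)
      by (intro integral_mono) (auto simp: abs_mult intro!: mult_right_mono)
    finally show ?thesis
      by simp
  qed
  then show ?thesis
    using that C(1) by blast
qed

text \<open>Here \<open>\<delta>\<close> comes from the uniform continuity of \<open>J\<close>
  alone, so it serves all \<open>g\<close> at once. Families bounded in the L1 norm therefore have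
  equicontinuous convolutions.\<close>

lemma conv_equicontinuous:
  assumes "\<eta> > 0"
  obtains \<delta> where "\<delta> > 0"
    "\<And>g x y. integrable M g \<Longrightarrow> dist x y < \<delta> \<Longrightarrow> \<bar>conv g x - conv g y\<bar> \<le> \<eta> * (\<integral>y. \<bar>g y\<bar> \<partial>M)"
proof -
  obtain \<delta> where \<delta>: "\<delta> > 0" "\<And>x y. dist x y < \<delta> \<Longrightarrow> \<bar>J x - J y\<bar> < \<eta>"
    using J_uniformly_continuous assms unfolding uniformly_continuous_on_def dist_real_def
    by (metis UNIV_I)
  have "\<bar>conv g x - conv g y\<bar> \<le> \<eta> * (\<integral>y. \<bar>g y\<bar> \<partial>M)"
    if g: "integrable M g" and xy: "dist x y < \<delta>" for g x y
  proof -
    note int = integrable_conv[OF g, of x] integrable_conv[OF g, of y]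
    have "conv g x - conv g y = (\<integral>z. J (x - z) * g z - J (y - z) * g z \<partial>M)"
      using int by simp
    also have "\<bar>\<dots>\<bar> \<le> (\<integral>z. \<bar>J (x - z) * g z - J (y - z) * g z\<bar> \<partial>M)"
      by (rule integral_abs_bound)
    also have "\<dots> \<le> (\<integral>z. \<eta> * \<bar>g z\<bar> \<partial>M)"
    proof (rule integral_mono)
      fix z
      have "\<bar>J (x - z) - J (y - z)\<bar> \<le> \<eta>"
        using \<delta>(2)[of "x - z" "y - z"] xy by (simp add: dist_norm)
      then show "\<bar>J (x - z) * g z - J (y - z) * g z\<bar> \<le> \<eta> * \<bar>g z\<bar>"
        by (metis abs_ge_zero abs_mult left_diff_distrib mult_right_mono)
    qed (use int g in auto)
    finally show ?thesis
      by simp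
  qed
  then show ?thesis
    using that \<delta>(1) by blast
qed

lemma conv_continuous:
  assumes g: "integrable M g"
  shows "continuous_on UNIV (conv g)"
  unfolding continuous_on_iff
proof (intro ballI allI impI)
  fix x and e :: real assume "e > 0"
  define I where "I = (\<integral>y. \<bar>g y\<bar> \<partial>M)"
  have "I \<ge> 0"
    unfolding I_def by simp
  \<comment> \<open>Dividing by \<open>I + 1\<close> avoids a zero denominator and keeps the
    resulting bound strictly below \<open>e\<close>.\<close>
  obtain \<delta> where \<delta>: "\<delta> > 0" "\<And>x y. dist x y < \<delta> \<Longrightarrow> \<bar>conv g x - conv g y\<bar> \<le> e / (I + 1) * I"
  proof (rule conv_equicontinuous[of "e / (I + 1)"])
    show "e / (I + 1) > 0"
      using \<open>e > 0\<close> \<open>I \<ge> 0\<close> by simp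
  qed (use g in \<open>simp add: I_def\<close>)
  moreover have "e / (I + 1) * I < e"
    using \<open>e > 0\<close> \<open>I \<ge> 0\<close> by (simp add: field_simps)
  ultimately show "\<exists>d>0. \<forall>x'\<in>UNIV. dist x' x < d \<longrightarrow> dist (conv g x') (conv g x) < e"
    unfolding dist_real_def by (intro exI[of _ \<delta>]) (auto intro: order_le_less_trans)
qed

section \<open>The weight function and the comparison principle\<close>

text \<open>The weight is a paraboloid cut off below at 1. Near \<open>\<Omega>\<close> convolution
  lowers the paraboloid by a fixed fraction of its maximum; far from \<open>\<Omega>\<close> the
  convolution over the domain is zero.\<close>

lemma supersolution:
  obtains \<psi> A \<theta> where "continuous_on UNIV \<psi>" "\<And>x. 1 \<le> \<psi> x" "\<And>x. \<psi> x \<le> A" "0 \<le> \<theta>" "\<theta> < 1"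
    "\<And>x. conv \<psi> x \<le> \<theta> * \<psi> x"
proof -
  obtain B where B: "B > 0" "\<And>z. norm z \<ge> B \<Longrightarrow> J z = 0"
    using supp_bound by blast
  obtain R where R: "R > 0" "\<And>y. y \<in> \<Omega> \<Longrightarrow> norm y \<le> R"
    using bounded_dom bounded_pos by metis
  \<comment> \<open>If \<open>norm x \<le> R + B\<close> and \<open>J (x - y)\<close> is nonzero,
    then \<open>norm y \<le> R + 2 * B\<close>. The choice of \<open>A\<close> makes the paraboloid
    at least 1 at all such \<open>y\<close>.\<close>
  define A where "A = 1 + (R + 2 * B)\<^sup>2"
  define c where "c = (\<integral>z. J z * (norm z)\<^sup>2 \<partial>lborel)"
  define p where "p y = A - (norm y)\<^sup>2" for y :: 'a
  define \<psi> where "\<psi> y = max 1 (p y)" for y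
  \<comment> \<open>Since \<open>p \<le> A\<close>, lowering by \<open>c\<close> is at least
    lowering by the fraction \<open>c / A\<close> of \<open>p\<close>.\<close>
  define \<theta> where "\<theta> = 1 - c / A"
  have A: "A \<ge> 1"
    by (simp add: A_def)
  have c_pos: "c > 0"
    unfolding c_def by (rule second_moment_pos)
  \<comment> \<open>The bound \<open>c \<le> A\<close>, obtained from the support radius
    \<open>B\<close>, ensures \<open>0 \<le> \<theta>\<close>.\<close>
  have "c \<le> (\<integral>z. B\<^sup>2 * J z \<partial>lborel)"
    unfolding c_def
  proof (rule integral_mono[OF integrable_J_square])
    show "J z * (norm z)\<^sup>2 \<le> B\<^sup>2 * J z" for z
    proof (cases "norm z \<ge> B")
      case False
      then show ?thesis
        using J_nonneg[of z] by (simp add: mult.commute mult_left_mono power_mono)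
    qed (use B in simp)
  qed (use integrable_J in simp)
  also have "\<dots> = B\<^sup>2"
    by (simp add: integral_J)
  also have "\<dots> \<le> (R + 2 * B)\<^sup>2"
    using B(1) R(1) by (intro power_mono) auto
  finally have "c \<le> A"
    by (simp add: A_def)
  then have \<theta>: "0 \<le> \<theta>" "\<theta> < 1"
    using c_pos A by (auto simp: \<theta>_def)
  have p_ge: "p y \<ge> 1" if "norm y \<le> R + 2 * B" for y
    using power_mono[OF that, of 2] by (simp add: p_def A_def)
  have "conv \<psi> x \<le> \<theta> * \<psi> x" for x
  proof (cases "norm x \<le> R + B")
    case True
    \<comment> \<open>The paraboloid may be negative far out, but only where
      \<open>J (x - y)\<close> is zero. The integrand being nonnegative, the integral over
      \<open>\<Omega>\<close> is at most the one over the whole space, which is known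
      exactly.\<close>
    have nonneg: "J (x - y) * p y \<ge> 0" for y
    proof (cases "norm (x - y) \<ge> B")
      case False
      have "norm y \<le> norm x + norm (x - y)"
        by (metis norm_minus_commute norm_triangle_sub)
      then have "p y \<ge> 1"
        using p_ge[of y] True False by simp
      then show ?thesis
        using J_nonneg[of "x - y"] by simp
    qed (use B in simp)
    have meas: "(\<lambda>y. J (x - y) * p y) \<in> borel_measurable lborel"
      unfolding p_def by measurable
    have int: "integrable lebesgue (\<lambda>y. J (x - y) * p y)"
      using integrable_J_paraboloid[of x A] integrable_completion[OF meas] by (simp add: p_def)
    \<comment> \<open>On \<open>\<Omega>\<close> the norm is at most \<open>R\<close>, so the
      truncation at 1 is inactive there.\<close>
    have "conv \<psi> x = conv p x"
      by (intro Bochner_Integration.integral_cong) (use R(2) B(1) p_ge in \<open>force simp: \<psi>_def\<close>)+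
    also have "\<dots> = (\<integral>y. indicator \<Omega> y *\<^sub>R (J (x - y) * p y) \<partial>lebesgue)"
      using sets_dom by (intro integral_restrict_space) simp
    also have "\<dots> \<le> (\<integral>y. J (x - y) * p y \<partial>lebesgue)"
      using int nonneg integrable_mult_indicator[OF sets_dom int]
      by (intro integral_mono) (auto simp: indicator_def)
    also have "\<dots> = p x - c"
      using J_convolve_paraboloid[of x A] integral_completion[OF meas] by (simp add: p_def c_def)
    also have "\<dots> \<le> \<theta> * p x"
    proof -
      have "c * p x \<le> c * A"
        using c_pos by (intro mult_left_mono) (auto simp: p_def)
      then have "c * p x / A \<le> c"
        using A by (simp add: field_simps)
      then show ?thesis
        by (simp add: \<theta>_def algebra_simps)
    qed
    also have "\<dots> \<le> \<theta> * \<psi> x"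
      using \<theta> by (intro mult_left_mono) (auto simp: \<psi>_def)
    finally show ?thesis .
  next
    case False
    have "J (x - y) = 0" if "y \<in> \<Omega>" for y
      using B(2)[of "x - y"] R(2)[OF that] False norm_triangle_ineq2[of x y] by simp
    then have "conv \<psi> x = conv (\<lambda>_. 0) x"
      by (intro Bochner_Integration.integral_cong) auto
    also have "\<dots> \<le> \<theta> * \<psi> x"
      using \<theta> by (simp add: \<psi>_def)
    finally show ?thesis .
  qed
  moreover have "continuous_on UNIV \<psi>"
    unfolding \<psi>_def p_def by (intro continuous_intros)
  ultimately show ?thesis
    using \<theta> A by (intro that[of \<psi> A \<theta>]) (auto simp: \<psi>_def p_def)
qed

interpretation M: finite_measure M
  by (rule finite_measure_M)

lemma integrable_M_bounded:
  fixes g :: "'a \<Rightarrow> real"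
  assumes "g \<in> borel_measurable M" "bounded (g ` \<Omega>)"
  shows "integrable M g"
proof -
  obtain C where "\<And>x. x \<in> \<Omega> \<Longrightarrow> \<bar>g x\<bar> \<le> C"
    using assms(2) unfolding bounded_iff by auto
  then show ?thesis
    using assms(1) by (intro M.integrable_const_bound[of _ C] AE_I2) auto
qed

lemma integrable_M_continuous_bounded:
  fixes g :: "'a \<Rightarrow> real"
  assumes "continuous_on UNIV g" "bounded (range g)"
  shows "integrable M g"
  using assms bounded_subset[OF assms(2), of "g ` \<Omega>"]
  by (intro integrable_M_bounded borel_imp_M borel_measurable_continuous_onI) auto

lemma L2_M_continuous_bounded:
  fixes g :: "'a \<Rightarrow> real"
  assumes "continuous_on UNIV g" "bounded (range g)"
  shows "L2 M g"
proof -
  obtain B where B: "\<And>x. \<bar>g x\<bar> \<le> B"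
    using assms(2) unfolding bounded_iff by auto
  have "(g x)\<^sup>2 \<le> B\<^sup>2" for x
    using B[of x] by (metis abs_ge_zero power2_abs power_mono)
  then have "bounded (range (\<lambda>x. (g x)\<^sup>2))"
    unfolding bounded_iff by auto
  with assms show ?thesis
    unfolding L2_def
    by (auto intro!: integrable_M_continuous_bounded continuous_intros borel_imp_M
        borel_measurable_continuous_onI)
qed

lemma conv_mono_abs:
  assumes "integrable M g" "integrable M k" "AE y in M. \<bar>g y\<bar> \<le> k y"
  shows "\<bar>conv g x\<bar> \<le> conv k x"
proof -
  have "\<bar>conv g x\<bar> \<le> (\<integral>y. \<bar>J (x - y) * g y\<bar> \<partial>M)"
    by (rule integral_abs_bound)
  also have "\<dots> \<le> conv k x"
  proof (rule integral_mono_AE)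
    show "AE y in M. \<bar>J (x - y) * g y\<bar> \<le> J (x - y) * k y"
      using assms(3) by eventually_elim (simp add: abs_mult J_nonneg mult_left_mono)
  qed (intro integrable_abs integrable_conv assms)+
  finally show ?thesis .
qed

text \<open>Let \<open>s\<close> be the supremum of \<open>\<bar>d\<bar> / \<psi>\<close>, finite
  because \<open>d\<close> is bounded. Inserting \<open>\<bar>d\<bar> \<le> s * \<psi>\<close> into
  the hypothesis gives \<open>s \<le> s * \<theta> + \<rho>\<close>, and \<open>\<theta> < 1\<close>
  lets \<open>s\<close> be absorbed. The constant \<open>K = A / (1 - \<theta>)\<close> is
  independent of \<open>d\<close> and \<open>\<rho>\<close>, which makes the estimate uniform in
  \<epsilon> later.\<close>

lemma maximum_principle:
  obtains K where "K > 0"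
    "\<And>d \<rho>. d \<in> borel_measurable M \<Longrightarrow> bounded (d ` \<Omega>) \<Longrightarrow> \<rho> \<ge> 0 \<Longrightarrow>
      \<forall>x\<in>\<Omega>. \<bar>d x\<bar> \<le> conv (\<lambda>y. \<bar>d y\<bar>) x + \<rho> \<Longrightarrow> \<forall>x\<in>\<Omega>. \<bar>d x\<bar> \<le> K * \<rho>"
proof -
  obtain \<psi> A \<theta> where \<psi>: "continuous_on UNIV \<psi>" "\<And>x. 1 \<le> \<psi> x" "\<And>x. \<psi> x \<le> A"
    and \<theta>: "0 \<le> \<theta>" "\<theta> < 1" "\<And>x. conv \<psi> x \<le> \<theta> * \<psi> x"
    using supersolution by blast
  have A: "A \<ge> 1"
    using \<psi> order_trans by blast
  have \<psi>_pos: "\<psi> x > 0" for x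
    using \<psi>(2)[of x] by linarith
  have "bounded (range \<psi>)"
    unfolding bounded_iff using \<psi>(3) \<psi>_pos by (intro exI[of _ A]) (auto simp: less_imp_le)
  then have int_\<psi>: "integrable M \<psi>"
    using \<psi>(1) by (intro integrable_M_continuous_bounded)
  have "\<forall>x\<in>\<Omega>. \<bar>d x\<bar> \<le> A / (1 - \<theta>) * \<rho>"
    if d: "d \<in> borel_measurable M" and bd: "bounded (d ` \<Omega>)" and "\<rho> \<ge> 0"
      and le: "\<forall>x\<in>\<Omega>. \<bar>d x\<bar> \<le> conv (\<lambda>y. \<bar>d y\<bar>) x + \<rho>" for d \<rho>
  proof
    fix x assume x: "x \<in> \<Omega>"
    define s where "s = (SUP x\<in>\<Omega>. \<bar>d x\<bar> / \<psi> x)"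
    obtain D where D: "\<And>x. x \<in> \<Omega> \<Longrightarrow> \<bar>d x\<bar> \<le> D"
      using bd unfolding bounded_iff by auto
    have "\<bar>d x\<bar> / \<psi> x \<le> D" if "x \<in> \<Omega>" for x
    proof -
      have "\<bar>d x\<bar> / \<psi> x \<le> \<bar>d x\<bar> / 1"
        using \<psi>(2)[of x] by (intro divide_left_mono) auto
      then show ?thesis
        using D[OF that] by simp
    qed
    then have bdd: "bdd_above ((\<lambda>x. \<bar>d x\<bar> / \<psi> x) ` \<Omega>)"
      by (intro bdd_aboveI2)
    have d_le: "\<bar>d y\<bar> \<le> s * \<psi> y" if "y \<in> \<Omega>" for y
      using cSUP_upper[OF that bdd] \<psi>_pos[of y] by (simp add: s_def pos_divide_le_eq)
    have "0 \<le> s * \<psi> x"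
      using d_le[OF x] by linarith
    then have "s \<ge> 0"
      using \<psi>_pos[of x] by (simp add: zero_le_mult_iff)
    have "s \<le> s * \<theta> + \<rho>"
      unfolding s_def
    proof (rule cSUP_least)
      fix z assume z: "z \<in> \<Omega>"
      have "\<bar>conv (\<lambda>y. \<bar>d y\<bar>) z\<bar> \<le> conv (\<lambda>y. s * \<psi> y) z"
        using int_\<psi> d_le integrable_M_bounded[OF d bd] by (intro conv_mono_abs AE_I2) auto
      also have "\<dots> = s * conv \<psi> z"
        by (simp add: mult.left_commute)
      also have "\<dots> \<le> s * (\<theta> * \<psi> z)"
        using \<theta>(3) \<open>s \<ge> 0\<close> by (rule mult_left_mono)
      finally have "\<bar>d z\<bar> \<le> s * \<theta> * \<psi> z + \<rho>"
        using le z by force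
      \<comment> \<open>The lower bound \<open>1 \<le> \<psi> z\<close> lets the additive error be
        measured in the weight as well.\<close>
      also have "\<dots> \<le> s * \<theta> * \<psi> z + \<rho> * \<psi> z"
        using \<open>\<rho> \<ge> 0\<close> \<psi>(2)[of z] by (simp add: mult_le_cancel_left1)
      finally have "\<bar>d z\<bar> / \<psi> z \<le> s * \<theta> + \<rho>"
        using \<psi>_pos[of z] by (simp add: pos_divide_le_eq distrib_right)
      then show "\<bar>d z\<bar> / \<psi> z \<le> (SUP x\<in>\<Omega>. \<bar>d x\<bar> / \<psi> x) * \<theta> + \<rho>"
        by (simp add: s_def)
    qed (use x in auto)
    then have "s \<le> \<rho> / (1 - \<theta>)"
      using \<theta>(2) by (simp add: pos_le_divide_eq algebra_simps)
    then have "s * \<psi> x \<le> \<rho> / (1 - \<theta>) * A"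
      using \<psi>(3)[of x] \<psi>_pos[of x] \<open>\<rho> \<ge> 0\<close> \<theta>(2) by (intro mult_mono) auto
    then show "\<bar>d x\<bar> \<le> A / (1 - \<theta>) * \<rho>"
      using d_le[OF x] by (simp add: mult.commute)
  qed
  moreover have "A / (1 - \<theta>) > 0"
    using A \<theta> by simp
  ultimately show ?thesis
    using that by blast
qed

section \<open>Solving the limit equation by contraction\<close>

text \<open>Banach's theorem is applied to the unknown \<open>z = w / \<psi>\<close>, for which the
  weighted sup norm of \<open>w\<close> becomes the ordinary norm of bounded continuous functions.
  In a difference of two images \<open>f\<close> cancels, \<open>\<bar>h\<bar> \<le> 1\<close>
  discards \<open>h\<close>, and the inequality for \<open>conv \<psi>\<close> yields the factor
  \<open>\<theta>\<close>.\<close>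

lemma fixed_point:
  assumes [measurable]: "h \<in> borel_measurable M" and h: "AE x in M. \<bar>h x\<bar> \<le> 1"
    and f: "integrable M f"
  obtains w where "continuous_on UNIV w" "bounded (range w)"
    "\<And>x. w x = conv (\<lambda>y. h y * (w y - f y)) x"
proof -
  obtain \<psi> A \<theta> where \<psi>: "continuous_on UNIV \<psi>" "\<And>x. 1 \<le> \<psi> x" "\<And>x. \<psi> x \<le> A"
    and \<theta>: "0 \<le> \<theta>" "\<theta> < 1" "\<And>x. conv \<psi> x \<le> \<theta> * \<psi> x"
    using supersolution by blast
  have \<psi>_pos: "\<psi> x > 0" for x
    using \<psi>(2)[of x] by linarith
  have bd_\<psi>: "bounded (range \<psi>)"
    unfolding bounded_iff using \<psi>(3) \<psi>_pos by (intro exI[of _ A]) (auto simp: less_imp_le)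
  then have int_\<psi>: "integrable M \<psi>"
    using \<psi>(1) by (intro integrable_M_continuous_bounded)
  obtain C where C: "\<And>g x. integrable M g \<Longrightarrow> \<bar>conv g x\<bar> \<le> C * (\<integral>y. \<bar>g y\<bar> \<partial>M)"
    by (rule conv_bounded) (rule that)
  have bd_mult: "bounded (range (\<lambda>y. \<psi> y * z y))" if z: "bounded (range z)" for z :: "'a \<Rightarrow> real"
  proof -
    obtain B where B: "\<And>y. \<bar>z y\<bar> \<le> B"
      using z unfolding bounded_iff by auto
    have "\<bar>\<psi> y * z y\<bar> \<le> A * B" for y
      unfolding abs_mult using B[of y] \<psi>(3)[of y] \<psi>_pos[of y] by (intro mult_mono) auto
    then show ?thesis
      unfolding bounded_iff by auto
  qed
  define g where "g z y = h y * (\<psi> y * apply_bcontfun z y - f y)" for z y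
  \<comment> \<open>This is the map \<open>w \<mapsto> conv (\<lambda>y. h y * (w y - f y))\<close>
    conjugated by multiplication with \<open>\<psi>\<close>.\<close>
  define T where "T z = Bcontfun (\<lambda>x. conv (g z) x / \<psi> x)" for z
  have int_\<psi>z: "integrable M (\<lambda>y. \<psi> y * apply_bcontfun z y)" for z
    using \<psi>(1) bd_mult by (intro integrable_M_continuous_bounded continuous_intros) auto
  have int_g: "integrable M (g z)" for z
    unfolding g_def using int_\<psi>z f h by (intro integrable_bounded_mult[where C = 1]) auto
  \<comment> \<open>\<open>Bcontfun\<close> is meaningful only on continuous bounded functions, so
    membership has to be shown before \<open>T z\<close> can be evaluated.\<close>
  have T: "apply_bcontfun (T z) x = conv (g z) x / \<psi> x" for z x
  proof -
    have "(\<lambda>x. conv (g z) x / \<psi> x) \<in> bcontfun"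
    proof (rule bcontfun_normI)
      show "continuous_on UNIV (\<lambda>x. conv (g z) x / \<psi> x)"
        using conv_continuous[OF int_g] \<psi>(1) \<psi>_pos
        by (intro continuous_on_divide) (auto simp: less_imp_neq[THEN not_sym])
      show "norm (conv (g z) x / \<psi> x) \<le> C * (\<integral>y. \<bar>g z y\<bar> \<partial>M)" for x
      proof -
        have "\<bar>conv (g z) x\<bar> / \<psi> x \<le> \<bar>conv (g z) x\<bar> / 1"
          using \<psi>(2)[of x] by (intro divide_left_mono) auto
        then show ?thesis
          using C[OF int_g[of z], of x] \<psi>_pos[of x] by simp
      qed
    qed
    then show ?thesis
      unfolding T_def by (simp add: Bcontfun_inverse)
  qed
  have "dist (T z) (T z') \<le> \<theta> * dist z z'" for z z'
  proof (rule dist_bound)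
    fix x
    have "conv (g z) x - conv (g z') x = conv (\<lambda>y. g z y - g z' y) x"
      using integrable_conv[OF int_g] by (simp add: right_diff_distrib)
    also have "\<bar>\<dots>\<bar> \<le> conv (\<lambda>y. dist z z' * \<psi> y) x"
    proof (rule conv_mono_abs)
      show "AE y in M. \<bar>g z y - g z' y\<bar> \<le> dist z z' * \<psi> y"
        using h
      proof eventually_elim
        case (elim y)
        have "g z y - g z' y = h y * (\<psi> y * (apply_bcontfun z y - apply_bcontfun z' y))"
          by (simp add: g_def algebra_simps)
        also have "\<bar>\<dots>\<bar> \<le> 1 * (\<psi> y * dist z z')"
          unfolding abs_mult using elim \<psi>_pos[of y] dist_bounded[where f = z and g = z' and x = y]
          by (intro mult_mono) (auto simp: dist_real_def)
        finally show ?case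
          by (simp add: mult.commute)
      qed
    qed (use int_g int_\<psi> in auto)
    also have "\<dots> = dist z z' * conv \<psi> x"
      by (simp add: mult.left_commute)
    also have "\<dots> \<le> dist z z' * (\<theta> * \<psi> x)"
      using \<theta>(3) by (intro mult_left_mono) auto
    finally have "\<bar>conv (g z) x - conv (g z') x\<bar> / \<psi> x \<le> \<theta> * dist z z'"
      using \<psi>_pos[of x] by (simp add: pos_divide_le_eq mult_ac)
    then show "dist (T z x) (T z' x) \<le> \<theta> * dist z z'"
      using \<psi>_pos[of x] by (simp add: T dist_real_def flip: diff_divide_distrib)
  qed
  then obtain z where z: "T z = z"
    using banach_fix_type[OF \<theta>(1,2), of T] by blast
  define w where "w x = \<psi> x * apply_bcontfun z x" for x
  have "continuous_on UNIV w"
    unfolding w_def using \<psi>(1) by (intro continuous_intros) auto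
  moreover have "bounded (range w)"
    unfolding w_def by (intro bd_mult) auto
  moreover have "w x = conv (\<lambda>y. h y * (w y - f y)) x" for x
  proof -
    have "w x = \<psi> x * (conv (g z) x / \<psi> x)"
      unfolding w_def using T[of z x] z by simp
    then show ?thesis
      using \<psi>_pos[of x] by (simp add: g_def w_def)
  qed
  ultimately show ?thesis
    using that by blast
qed

section \<open>From weak-star convergence to uniform convergence of convolutions\<close>

text \<open>For fixed \<open>x\<close> the function \<open>J (x - y) * g y\<close> of
  \<open>y\<close> is integrable, hence an admissible test function, which gives the pointwise
  limit. Since \<open>\<bar>Y \<epsilon> - X\<bar> \<le> 2\<close> almost everywhere, the convolved
  functions are bounded in the L1 norm uniformly in \<epsilon>, which gives equicontinuity.\<close>

lemma weak_star_conv_uniform: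
  assumes X: "X \<in> borel_measurable M" "AE x in M. \<bar>X x\<bar> \<le> 1"
    and Y: "\<forall>\<^sub>F \<epsilon> in F. Y \<epsilon> \<in> borel_measurable M \<and> (AE x in M. \<bar>Y \<epsilon> x\<bar> \<le> 1)"
    and lim: "weakly_star_tendsto_L_infty M Y X F"
    and g: "integrable M g" and "\<eta> > 0"
  shows "\<forall>\<^sub>F \<epsilon> in F. \<forall>x\<in>\<Omega>. \<bar>conv (\<lambda>y. (Y \<epsilon> y - X y) * g y) x\<bar> \<le> \<eta>"
proof (rule tendsto_uniform_on_bounded[OF bounded_dom _ _ \<open>\<eta> > 0\<close>])
  fix x
  have *: "((\<lambda>\<epsilon>. (\<integral>y. Y \<epsilon> y * (J (x - y) * g y) \<partial>M) - (\<integral>y. X y * (J (x - y) * g y) \<partial>M)) \<longlongrightarrow> 0) F"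
    using lim integrable_conv[OF g, of x] unfolding weakly_star_tendsto_L_infty_def
    by (subst LIM_zero_iff) blast
  have "\<forall>\<^sub>F \<epsilon> in F. (\<integral>y. Y \<epsilon> y * (J (x - y) * g y) \<partial>M) - (\<integral>y. X y * (J (x - y) * g y) \<partial>M) =
    conv (\<lambda>y. (Y \<epsilon> y - X y) * g y) x"
    using Y
  proof eventually_elim
    case (elim \<epsilon>)
    then have "integrable M (\<lambda>y. Y \<epsilon> y * (J (x - y) * g y))" "integrable M (\<lambda>y. X y * (J (x - y) * g y))"
      using X integrable_conv[OF g, of x] by (auto intro!: integrable_bounded_mult)
    then show ?case
      by (subst Bochner_Integration.integral_diff[symmetric]) (simp_all add: algebra_simps)
  qed
  with * show "((\<lambda>\<epsilon>. conv (\<lambda>y. (Y \<epsilon> y - X y) * g y) x) \<longlongrightarrow> 0) F"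
    by (rule Lim_transform_eventually)
next
  fix \<eta>' :: real assume "\<eta>' > 0"
  define I where "I = (\<integral>y. \<bar>g y\<bar> \<partial>M)"
  have "I \<ge> 0"
    unfolding I_def by simp
  \<comment> \<open>The L1 norms in question are at most \<open>2 * I\<close>; the added 1 keeps the
    denominator positive.\<close>
  obtain \<delta> where \<delta>: "\<delta> > 0" "\<And>g x y. integrable M g \<Longrightarrow> dist x y < \<delta> \<Longrightarrow>
      \<bar>conv g x - conv g y\<bar> \<le> \<eta>' / (2 * I + 1) * (\<integral>y. \<bar>g y\<bar> \<partial>M)"
  proof (rule conv_equicontinuous[of "\<eta>' / (2 * I + 1)"])
    show "\<eta>' / (2 * I + 1) > 0"
      using \<open>\<eta>' > 0\<close> \<open>I \<ge> 0\<close> by simp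
  qed blast
  have "\<forall>\<^sub>F \<epsilon> in F. \<forall>x y. dist x y < \<delta> \<longrightarrow>
    \<bar>conv (\<lambda>y. (Y \<epsilon> y - X y) * g y) x - conv (\<lambda>y. (Y \<epsilon> y - X y) * g y) y\<bar> \<le> \<eta>'"
    using Y
  proof eventually_elim
    case (elim \<epsilon>)
    have le: "AE y in M. \<bar>Y \<epsilon> y - X y\<bar> \<le> 2"
      using elim[THEN conjunct2] X(2) by eventually_elim linarith
    have int: "integrable M (\<lambda>y. (Y \<epsilon> y - X y) * g y)"
      using elim X g le by (intro integrable_bounded_mult[where C = 2]) auto
    have "(\<integral>y. \<bar>(Y \<epsilon> y - X y) * g y\<bar> \<partial>M) \<le> (\<integral>y. 2 * \<bar>g y\<bar> \<partial>M)"
    proof (rule integral_mono_AE)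
      show "AE y in M. \<bar>(Y \<epsilon> y - X y) * g y\<bar> \<le> 2 * \<bar>g y\<bar>"
        using le by eventually_elim (simp add: abs_mult mult_right_mono)
    qed (use int g in auto)
    then have "(\<integral>y. \<bar>(Y \<epsilon> y - X y) * g y\<bar> \<partial>M) \<le> 2 * I + 1"
      by (simp add: I_def)
    then have "\<eta>' / (2 * I + 1) * (\<integral>y. \<bar>(Y \<epsilon> y - X y) * g y\<bar> \<partial>M) \<le> \<eta>' / (2 * I + 1) * (2 * I + 1)"
      using \<open>\<eta>' > 0\<close> \<open>I \<ge> 0\<close> by (intro mult_left_mono) auto
    also have "\<dots> = \<eta>'"
      using \<open>I \<ge> 0\<close> by simp
    finally show ?case
      using \<delta>(2)[OF int] by (meson order_trans)
  qed
  then show "\<exists>\<delta>>0. \<forall>\<^sub>F \<epsilon> in F. \<forall>x y. dist x y < \<delta> \<longrightarrow>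
    \<bar>conv (\<lambda>y. (Y \<epsilon> y - X y) * g y) x - conv (\<lambda>y. (Y \<epsilon> y - X y) * g y) y\<bar> \<le> \<eta>'"
    using \<delta>(1) by blast
qed

text \<open>The unit mass of \<open>J\<close> produces the term \<open>- c\<close>, and the integral
  of \<open>J (x - y) * u y\<close> reduces to \<open>\<Omega>\<close> because \<open>u\<close>
  vanishes almost everywhere outside. With \<open>c = u x\<close> this rewrites
  \<open>nonlocal_op\<close>.\<close>

lemma nonlocal_integral_eq:
  assumes [measurable]: "u \<in> borel_measurable lebesgue" and u: "integrable M u"
    and 0: "AE y in lebesgue. y \<notin> \<Omega> \<longrightarrow> u y = 0"
  shows "(\<integral>y. J (x - y) * (u y - c) \<partial>lebesgue) = conv u x - c"
proof -
  have Jx: "(\<lambda>y. J (x - y)) \<in> borel_measurable lborel"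
    by measurable
  then have [measurable]: "(\<lambda>y. J (x - y)) \<in> borel_measurable lebesgue"
    by (rule measurable_completion)
  have J: "integrable lebesgue (\<lambda>y. J (x - y))" "(\<integral>y. J (x - y) \<partial>lebesgue) = 1"
    using integrable_completion[OF Jx] integral_completion[OF Jx] integrable_J integral_J
      lborel_integral_reflect_shift[OF J_borel, of x] by auto
  have eq: "AE y in lebesgue. indicator \<Omega> y *\<^sub>R (J (x - y) * u y) = J (x - y) * u y"
    using 0 by eventually_elim (auto simp: indicator_def)
  have int_ind: "integrable lebesgue (\<lambda>y. indicator \<Omega> y *\<^sub>R (J (x - y) * u y))"
    using integrable_conv[OF u, of x] sets_dom by (subst (asm) integrable_restrict_space) auto
  have int: "integrable lebesgue (\<lambda>y. J (x - y) * u y)"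
    by (rule integrable_cong_AE_imp[OF int_ind]) (use eq in \<open>auto elim: eventually_mono\<close>)
  have "conv u x = (\<integral>y. indicator \<Omega> y *\<^sub>R (J (x - y) * u y) \<partial>lebesgue)"
    using sets_dom by (intro integral_restrict_space) simp
  also have "\<dots> = (\<integral>y. J (x - y) * u y \<partial>lebesgue)"
    using eq int_ind int by (intro integral_cong_AE) auto
  finally show ?thesis
    using int J by (simp add: right_diff_distrib)
qed

end

section \<open>Passage to the limit in the Dirichlet problems\<close>

theorem theorem1p1:
  fixes \<Omega> :: "(real ^ 'n) set"
    and \<Omega>e :: "real \<Rightarrow> (real ^ 'n) set"
    and X J f :: "real ^ 'n \<Rightarrow> real"
    and u :: "real \<Rightarrow> real ^ 'n \<Rightarrow> real"
  assumes \<Omega>: "open \<Omega>" "connected \<Omega>" "bounded \<Omega>"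
    and \<Omega>e: "\<And>\<epsilon>. \<epsilon> > 0 \<Longrightarrow> open (\<Omega>e \<epsilon>) \<and> bounded (\<Omega>e \<epsilon>) \<and> \<Omega>e \<epsilon> \<subseteq> \<Omega>"
    and X: "L_infty lebesgue X"
      "AE x in lebesgue. 0 \<le> X x \<and> X x \<le> 1"
      "AE x in lebesgue. x \<notin> \<Omega> \<longrightarrow> X x = 0"
    and J: "continuous_on UNIV J" "\<And>x. J x \<ge> 0" "compact (closure {x. J x \<noteq> 0})"
      "J 0 > 0" "\<And>x. J (- x) = J x" "(\<integral>x. J x \<partial>lebesgue) = 1"
    and f: "L2 (lebesgue_on \<Omega>) f"
    and \<chi>: "weakly_star_tendsto_L_infty (lebesgue_on \<Omega>) (\<lambda>\<epsilon>. indicator (\<Omega>e \<epsilon>)) X (at_right 0)"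
    and u: "\<And>\<epsilon>. \<epsilon> > 0 \<Longrightarrow> nonlocal_dirichlet_solution J f (\<Omega>e \<epsilon>) (u \<epsilon>)"
  shows "\<exists>v :: real ^ 'n \<Rightarrow> real.
           L2 (lebesgue_on \<Omega>) v \<and>
           weakly_tendsto_L2 (lebesgue_on \<Omega>) (\<lambda>\<epsilon>. zero_ext (\<Omega>e \<epsilon>) (u \<epsilon>)) v (at_right 0) \<and>
           (AE x in lebesgue_on \<Omega>. X x * f x = X x * nonlocal_op J v x - (1 - X x) * v x) \<and>
           (\<forall>x. x \<notin> \<Omega> \<longrightarrow> v x = 0)"
proof -
  have sets_\<Omega>: "\<Omega> \<in> sets lebesgue"
    using \<Omega>(1) by (simp add: lborelD)
  interpret D: dispersal_kernel \<Omega> J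
    using \<Omega>(3) sets_\<Omega> J by unfold_locales auto
  interpret M: finite_measure D.M
    by (rule D.finite_measure_M)
  have AE_M: "AE x in D.M. P x" if "AE x in lebesgue. x \<in> \<Omega> \<longrightarrow> P x" for P
    using that sets_\<Omega> by (subst AE_restrict_space_iff) auto
  have meas_M: "g \<in> borel_measurable D.M" if "g \<in> borel_measurable lebesgue" for g :: "real^'n \<Rightarrow> real"
    using that by (rule measurable_restrict_space1)
  have X_M: "X \<in> borel_measurable D.M" "AE x in D.M. \<bar>X x\<bar> \<le> 1"
  proof -
    show "X \<in> borel_measurable D.M"
      using X(1) by (intro meas_M) (simp add: L_infty_def)
    show "AE x in D.M. \<bar>X x\<bar> \<le> 1"
      by (rule AE_M, use X(2) in eventually_elim) auto
  qed
  have ind_M: "(indicator (\<Omega>e \<epsilon>) :: _ \<Rightarrow> real) \<in> borel_measurable D.M" if "\<epsilon> > 0" for \<epsilon>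
    using \<Omega>e[OF that] by (intro D.borel_imp_M) auto
  have ind_le: "AE x in D.M. \<bar>indicator (\<Omega>e \<epsilon>) x :: real\<bar> \<le> 1" for \<epsilon>
    by (simp add: indicator_def)
  have int_f: "integrable D.M f"
    using f by (auto simp: L2_def intro: M.square_integrable_imp_integrable)
  have pos: "\<forall>\<^sub>F \<epsilon> in at_right 0. (\<epsilon>::real) > 0"
    by (rule eventually_at_right_less)

  \<comment> \<open>With the weight \<open>X\<close> the fixed point depends on \<open>X\<close> and
    \<open>f\<close> but not on \<epsilon>; it is the candidate limit of
    \<open>D.conv (u \<epsilon>)\<close>.\<close>
  obtain w where w: "continuous_on UNIV w" "bounded (range w)"
    "\<And>x. w x = D.conv (\<lambda>y. X y * (w y - f y)) x"
    using D.fixed_point[OF X_M int_f] by blast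
  have w_M: "integrable D.M w"
    using w by (intro D.integrable_M_continuous_bounded)
  define g where "g y = w y - f y" for y
  have L2_g: "L2 D.M g"
    unfolding g_def using f D.L2_M_continuous_bounded[OF w(1,2)] w_M int_f
    by (auto simp: L2_def power2_diff mult.assoc intro!: Bochner_Integration.integrable_diff
        Bochner_Integration.integrable_add integrable_mult_right L2_mult_integrable)
  have int_g: "integrable D.M g"
    using w_M int_f by (simp add: g_def[abs_def])
  have L2_Xg: "L2 D.M (\<lambda>x. X x * g x)"
    by (rule L2_bounded_mult[OF L2_g X_M])
  \<comment> \<open>The indicator makes \<open>v\<close> vanish at every point outside
    \<open>\<Omega>\<close>, whereas \<open>X\<close> is known to vanish there only almost
    everywhere.\<close>
  define v where "v x = indicator \<Omega> x *\<^sub>R (X x * g x)" for x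
  have v_\<Omega>: "v x = X x * g x" if "x \<in> \<Omega>" for x
    using that by (simp add: v_def)
  have L2_v: "L2 D.M v"
  proof -
    have "L2 D.M v \<longleftrightarrow> L2 D.M (\<lambda>x. X x * g x)"
      unfolding L2_def
      by (intro conj_cong measurable_cong Bochner_Integration.integrable_cong) (auto simp: v_\<Omega>)
    with L2_Xg show ?thesis
      by simp
  qed

  have int_solution: "integrable D.M (u \<epsilon>)" if "\<epsilon> > 0" for \<epsilon>
  proof (rule M.square_integrable_imp_integrable)
    have L2: "L2 lebesgue (u \<epsilon>)"
      using u[OF that] by (simp add: nonlocal_dirichlet_solution_def)
    then show "u \<epsilon> \<in> borel_measurable D.M"
      by (auto simp: L2_def intro: meas_M)
    have "integrable lebesgue (\<lambda>x. indicator \<Omega> x *\<^sub>R (u \<epsilon> x)\<^sup>2)"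
      using L2 sets_\<Omega> by (intro integrable_mult_indicator) (auto simp: L2_def)
    then show "integrable D.M (\<lambda>x. (u \<epsilon> x)\<^sup>2)"
      using sets_\<Omega> by (subst integrable_restrict_space) auto
  qed
  \<comment> \<open>Rewriting the operator as \<open>D.conv (u \<epsilon>) - u \<epsilon>\<close>
    solves the equation for \<open>u \<epsilon>\<close> on \<open>\<Omega>e \<epsilon>\<close>; the
    indicator also encodes the exterior condition.\<close>
  have solution_eq: "AE y in D.M. u \<epsilon> y = indicator (\<Omega>e \<epsilon>) y * (D.conv (u \<epsilon>) y - f y)"
    if "\<epsilon> > 0" for \<epsilon>
  proof (rule AE_M)
    have sol: "u \<epsilon> \<in> borel_measurable lebesgue"
      "AE x in lebesgue. x \<in> \<Omega>e \<epsilon> \<longrightarrow> f x = nonlocal_op J (u \<epsilon>) x"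
      "AE x in lebesgue. x \<notin> \<Omega>e \<epsilon> \<longrightarrow> u \<epsilon> x = 0"
      using u[OF that] by (auto simp: nonlocal_dirichlet_solution_def L2_def)
    have "AE x in lebesgue. x \<notin> \<Omega> \<longrightarrow> u \<epsilon> x = 0"
      using sol(3) by eventually_elim (use \<Omega>e[OF that] in auto)
    then have op_eq: "nonlocal_op J (u \<epsilon>) x = D.conv (u \<epsilon>) x - u \<epsilon> x" for x
      unfolding nonlocal_op_def by (intro D.nonlocal_integral_eq sol int_solution that)
    from sol(2,3) show "AE y in lebesgue. y \<in> \<Omega> \<longrightarrow> u \<epsilon> y = indicator (\<Omega>e \<epsilon>) y * (D.conv (u \<epsilon>) y - f y)"
      by eventually_elim (auto simp: indicator_def op_eq)
  qed

  \<comment> \<open>The comparison is made between convolutions, which are continuous and bounded,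
    while \<open>u \<epsilon>\<close> itself is only known to be square integrable.\<close>
  define d where "d \<epsilon> x = D.conv (u \<epsilon>) x - w x" for \<epsilon> x
  have d_cont: "continuous_on UNIV (d \<epsilon>)" if "\<epsilon> > 0" for \<epsilon>
    unfolding d_def using D.conv_continuous[OF int_solution[OF that]] w(1)
    by (intro continuous_intros)
  have d_bounded: "bounded (range (d \<epsilon>))" if "\<epsilon> > 0" for \<epsilon>
  proof -
    note int_u = int_solution[OF that]
    obtain C where "\<And>x. \<bar>D.conv (u \<epsilon>) x\<bar> \<le> C * (\<integral>y. \<bar>u \<epsilon> y\<bar> \<partial>D.M)"
      by (rule D.conv_bounded) (use int_u in blast)
    then have "bounded (range (D.conv (u \<epsilon>)))"
      unfolding bounded_iff by auto
    then show ?thesis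
      unfolding d_def using w(2) by (rule bounded_minus_comp)
  qed
  have int_d: "integrable D.M (d \<epsilon>)" if "\<epsilon> > 0" for \<epsilon>
    using d_cont[OF that] d_bounded[OF that] by (rule D.integrable_M_continuous_bounded)

  define r where "r \<epsilon> x = D.conv (\<lambda>y. (indicator (\<Omega>e \<epsilon>) y - X y) * g y) x" for \<epsilon> x
  \<comment> \<open>Insert \<open>u \<epsilon> = indicator (\<Omega>e \<epsilon>) * (d \<epsilon> +
    g)\<close> into the convolution and subtract \<open>w = D.conv (\<lambda>y. X y * g y)\<close>;
    what remains besides \<open>d \<epsilon>\<close> is the weak-star error
    \<open>r \<epsilon>\<close>.\<close>
  have d_eq: "d \<epsilon> x = D.conv (\<lambda>y. indicator (\<Omega>e \<epsilon>) y * d \<epsilon> y) x + r \<epsilon> x" if "\<epsilon> > 0" for \<epsilon> x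
  proof -
    have int1: "integrable D.M (\<lambda>y. indicator (\<Omega>e \<epsilon>) y * d \<epsilon> y)"
      by (rule integrable_bounded_mult[OF int_d[OF that] ind_M[OF that] ind_le])
    have int2: "integrable D.M (\<lambda>y. indicator (\<Omega>e \<epsilon>) y * g y)"
      by (rule integrable_bounded_mult[OF int_g ind_M[OF that] ind_le])
    have int3: "integrable D.M (\<lambda>y. X y * g y)"
      by (rule integrable_bounded_mult[OF int_g X_M])
    have "D.conv (u \<epsilon>) x =
      D.conv (\<lambda>y. indicator (\<Omega>e \<epsilon>) y * d \<epsilon> y + indicator (\<Omega>e \<epsilon>) y * g y) x"
    proof (rule integral_cong_AE)
      show "AE y in D.M. J (x - y) * u \<epsilon> y =
        J (x - y) * (indicator (\<Omega>e \<epsilon>) y * d \<epsilon> y + indicator (\<Omega>e \<epsilon>) y * g y)"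
        using solution_eq[OF that]
      proof eventually_elim
        case (elim y)
        have "u \<epsilon> y = indicator (\<Omega>e \<epsilon>) y * d \<epsilon> y + indicator (\<Omega>e \<epsilon>) y * g y"
          unfolding distrib_left[symmetric] by (simp add: d_def g_def elim)
        then show ?case
          by (rule arg_cong)
      qed
    qed (intro borel_measurable_integrable D.integrable_conv int_solution that
        Bochner_Integration.integrable_add int1 int2)+
    moreover have "w x = D.conv (\<lambda>y. X y * g y) x"
      unfolding g_def by (rule w(3))
    ultimately show ?thesis
      unfolding d_def[of \<epsilon> x] r_def
      using D.integrable_conv[OF int1, of x] D.integrable_conv[OF int2, of x] D.integrable_conv[OF int3, of x]
      by (simp add: distrib_left left_diff_distrib right_diff_distrib)
  qed
  have r_small: "\<forall>\<^sub>F \<epsilon> in at_right 0. \<forall>x\<in>\<Omega>. \<bar>r \<epsilon> x\<bar> \<le> \<eta>" if "\<eta> > 0" for \<eta>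
    unfolding r_def
  proof (rule D.weak_star_conv_uniform[OF X_M _ \<chi> int_g that])
    show "\<forall>\<^sub>F \<epsilon> in at_right 0. (indicator (\<Omega>e \<epsilon>) :: _ \<Rightarrow> real) \<in> borel_measurable D.M \<and>
      (AE x in D.M. \<bar>indicator (\<Omega>e \<epsilon>) x :: real\<bar> \<le> 1)"
      using pos by eventually_elim (use ind_M ind_le in blast)
  qed
  have d_small: "\<forall>\<^sub>F \<epsilon> in at_right 0. \<forall>x\<in>\<Omega>. \<bar>d \<epsilon> x\<bar> \<le> \<eta>" if "\<eta> > 0" for \<eta>
  proof -
    \<comment> \<open>\<open>K\<close> is fixed before \<epsilon>, so making
      \<open>r \<epsilon>\<close> smaller than \<open>\<eta> / K\<close> uniformly suffices. The
      comparison principle applies after the indicator in \<open>d_eq\<close> is bounded by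
      1.\<close>
    obtain K where K: "K > 0" "\<And>d \<rho>. d \<in> borel_measurable D.M \<Longrightarrow> bounded (d ` \<Omega>) \<Longrightarrow> \<rho> \<ge> 0 \<Longrightarrow>
      \<forall>x\<in>\<Omega>. \<bar>d x\<bar> \<le> D.conv (\<lambda>y. \<bar>d y\<bar>) x + \<rho> \<Longrightarrow> \<forall>x\<in>\<Omega>. \<bar>d x\<bar> \<le> K * \<rho>"
      using D.maximum_principle by blast
    have "\<eta> / K > 0"
      using that K(1) by simp
    from r_small[OF this] pos show ?thesis
    proof eventually_elim
      case (elim \<epsilon>)
      have "\<forall>x\<in>\<Omega>. \<bar>d \<epsilon> x\<bar> \<le> K * (\<eta> / K)"
      proof (rule K(2))
        show "d \<epsilon> \<in> borel_measurable D.M"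
          using int_d[OF elim(2)] by simp
        show "bounded (d \<epsilon> ` \<Omega>)"
          using d_bounded[OF elim(2)] by (rule bounded_subset) auto
        show "\<forall>x\<in>\<Omega>. \<bar>d \<epsilon> x\<bar> \<le> D.conv (\<lambda>y. \<bar>d \<epsilon> y\<bar>) x + \<eta> / K"
        proof
          fix x assume "x \<in> \<Omega>"
          have "\<bar>D.conv (\<lambda>y. indicator (\<Omega>e \<epsilon>) y * d \<epsilon> y) x\<bar> \<le> D.conv (\<lambda>y. \<bar>d \<epsilon> y\<bar>) x"
            using integrable_bounded_mult[OF int_d ind_M ind_le, OF elim(2) elim(2)] int_d[OF elim(2)]
            by (intro D.conv_mono_abs AE_I2) (auto simp: indicator_def)
          moreover have "\<bar>r \<epsilon> x\<bar> \<le> \<eta> / K"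
            using elim(1) \<open>x \<in> \<Omega>\<close> by blast
          ultimately show "\<bar>d \<epsilon> x\<bar> \<le> D.conv (\<lambda>y. \<bar>d \<epsilon> y\<bar>) x + \<eta> / K"
            unfolding d_eq[OF elim(2), of x] by linarith
        qed
      qed (use \<open>\<eta> / K > 0\<close> in auto)
      then show ?case
        using K(1) by simp
    qed
  qed

  have "weakly_tendsto_L2 D.M (\<lambda>\<epsilon>. zero_ext (\<Omega>e \<epsilon>) (u \<epsilon>)) v (at_right 0)"
    unfolding weakly_tendsto_L2_def
  proof (intro allI impI)
    fix \<phi> assume \<phi>: "L2 D.M \<phi>"
    then have int_\<phi>: "integrable D.M \<phi>"
      by (auto simp: L2_def intro: M.square_integrable_imp_integrable)
    have int_g\<phi>: "integrable D.M (\<lambda>x. g x * \<phi> x)"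
      using L2_g \<phi> by (rule L2_mult_integrable)
    have int_d\<phi>: "integrable D.M (\<lambda>x. d \<epsilon> x * \<phi> x)" if "\<epsilon> > 0" for \<epsilon>
      using D.L2_M_continuous_bounded[OF d_cont d_bounded, OF that that] \<phi> by (rule L2_mult_integrable)
    have int_ind: "integrable D.M (\<lambda>x. indicator (\<Omega>e \<epsilon>) x * k x)" if "\<epsilon> > 0" "integrable D.M k"
      for \<epsilon> and k :: "real ^ 'n \<Rightarrow> real"
      by (rule integrable_bounded_mult[OF that(2) ind_M[OF that(1)] ind_le])
    \<comment> \<open>The factor \<open>d \<epsilon>\<close> tends to 0 uniformly on
      \<open>\<Omega>\<close>, and \<open>\<phi>\<close> is integrable because the domain has finite
      measure.\<close>
    have lim0: "((\<lambda>\<epsilon>. \<integral>x. indicator (\<Omega>e \<epsilon>) x * (d \<epsilon> x * \<phi> x) \<partial>D.M) \<longlongrightarrow> 0) (at_right 0)"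
    proof (rule tendstoI)
      fix e :: real assume "e > 0"
      define I where "I = (\<integral>x. \<bar>\<phi> x\<bar> \<partial>D.M)"
      have "I \<ge> 0"
        unfolding I_def by simp
      have "e / (I + 1) > 0"
        using \<open>e > 0\<close> \<open>I \<ge> 0\<close> by simp
      from d_small[OF this] pos
      show "\<forall>\<^sub>F \<epsilon> in at_right 0. dist (\<integral>x. indicator (\<Omega>e \<epsilon>) x * (d \<epsilon> x * \<phi> x) \<partial>D.M) 0 < e"
      proof eventually_elim
        case (elim \<epsilon>)
        have "\<bar>\<integral>x. indicator (\<Omega>e \<epsilon>) x * (d \<epsilon> x * \<phi> x) \<partial>D.M\<bar> \<le>
          (\<integral>x. \<bar>indicator (\<Omega>e \<epsilon>) x * (d \<epsilon> x * \<phi> x)\<bar> \<partial>D.M)"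
          by (rule integral_abs_bound)
        also have "\<dots> \<le> (\<integral>x. e / (I + 1) * \<bar>\<phi> x\<bar> \<partial>D.M)"
        proof (rule integral_mono)
          show "integrable D.M (\<lambda>x. \<bar>indicator (\<Omega>e \<epsilon>) x * (d \<epsilon> x * \<phi> x)\<bar>)"
            by (intro integrable_abs int_ind int_d\<phi> elim)
          show "integrable D.M (\<lambda>x. e / (I + 1) * \<bar>\<phi> x\<bar>)"
            by (intro integrable_mult_right integrable_abs int_\<phi>)
          fix x assume "x \<in> space D.M"
          then have "\<bar>d \<epsilon> x\<bar> * \<bar>\<phi> x\<bar> \<le> e / (I + 1) * \<bar>\<phi> x\<bar>"
            using elim(1) by (intro mult_right_mono) auto
          moreover have "\<bar>indicator (\<Omega>e \<epsilon>) x * (d \<epsilon> x * \<phi> x)\<bar> \<le> \<bar>d \<epsilon> x\<bar> * \<bar>\<phi> x\<bar>"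
            by (simp add: indicator_def abs_mult)
          ultimately show "\<bar>indicator (\<Omega>e \<epsilon>) x * (d \<epsilon> x * \<phi> x)\<bar> \<le> e / (I + 1) * \<bar>\<phi> x\<bar>"
            by linarith
        qed
        also have "\<dots> = e / (I + 1) * I"
          by (simp add: I_def)
        also have "\<dots> < e"
          using \<open>e > 0\<close> \<open>I \<ge> 0\<close> by (simp add: field_simps)
        finally show ?case
          by (simp add: dist_real_def)
      qed
    qed
    \<comment> \<open>As a product of two square-integrable functions, \<open>g x * \<phi> x\<close>
      is integrable and so an admissible test function for the weak-star convergence.\<close>
    have lim1: "((\<lambda>\<epsilon>. \<integral>x. indicator (\<Omega>e \<epsilon>) x * (g x * \<phi> x) \<partial>D.M) \<longlongrightarrow>
      (\<integral>x. X x * (g x * \<phi> x) \<partial>D.M)) (at_right 0)"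
      using \<chi> int_g\<phi> unfolding weakly_star_tendsto_L_infty_def by blast
    have "\<forall>\<^sub>F \<epsilon> in at_right 0.
      (\<integral>x. indicator (\<Omega>e \<epsilon>) x * (d \<epsilon> x * \<phi> x) \<partial>D.M) + (\<integral>x. indicator (\<Omega>e \<epsilon>) x * (g x * \<phi> x) \<partial>D.M) =
      (\<integral>x. zero_ext (\<Omega>e \<epsilon>) (u \<epsilon>) x * \<phi> x \<partial>D.M)"
      using pos
    proof eventually_elim
      case (elim \<epsilon>)
      note int = int_ind[OF elim int_d\<phi>[OF elim]] int_ind[OF elim int_g\<phi>]
      have "(\<integral>x. indicator (\<Omega>e \<epsilon>) x * (d \<epsilon> x * \<phi> x) \<partial>D.M) + (\<integral>x. indicator (\<Omega>e \<epsilon>) x * (g x * \<phi> x) \<partial>D.M) =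
        (\<integral>x. indicator (\<Omega>e \<epsilon>) x * (d \<epsilon> x * \<phi> x) + indicator (\<Omega>e \<epsilon>) x * (g x * \<phi> x) \<partial>D.M)"
        using int by simp
      also have "\<dots> = (\<integral>x. zero_ext (\<Omega>e \<epsilon>) (u \<epsilon>) x * \<phi> x \<partial>D.M)"
      proof (rule integral_cong_AE)
        have "zero_ext (\<Omega>e \<epsilon>) (u \<epsilon>) = (\<lambda>x. indicator (\<Omega>e \<epsilon>) x * u \<epsilon> x)"
          by (auto simp: zero_ext_def indicator_def)
        then show "(\<lambda>x. zero_ext (\<Omega>e \<epsilon>) (u \<epsilon>) x * \<phi> x) \<in> borel_measurable D.M"
          using ind_M[OF elim] int_solution[OF elim] int_\<phi> by (auto intro!: borel_measurable_times)
        show "AE x in D.M. indicator (\<Omega>e \<epsilon>) x * (d \<epsilon> x * \<phi> x) + indicator (\<Omega>e \<epsilon>) x * (g x * \<phi> x) =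
          zero_ext (\<Omega>e \<epsilon>) (u \<epsilon>) x * \<phi> x"
          using solution_eq[OF elim]
        proof eventually_elim
          case (elim x)
          have "indicator (\<Omega>e \<epsilon>) x * (d \<epsilon> x * \<phi> x) + indicator (\<Omega>e \<epsilon>) x * (g x * \<phi> x) =
            indicator (\<Omega>e \<epsilon>) x * (d \<epsilon> x + g x) * \<phi> x"
            by (simp add: algebra_simps)
          also have "d \<epsilon> x + g x = D.conv (u \<epsilon>) x - f x"
            by (simp add: d_def g_def)
          also have "indicator (\<Omega>e \<epsilon>) x * \<dots> = zero_ext (\<Omega>e \<epsilon>) (u \<epsilon>) x"
            using elim by (simp add: zero_ext_def)
          finally show ?case .
        qed
      qed (use int in auto)
      finally show ?case .
    qed
    with tendsto_add[OF lim0 lim1]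
    have "((\<lambda>\<epsilon>. \<integral>x. zero_ext (\<Omega>e \<epsilon>) (u \<epsilon>) x * \<phi> x \<partial>D.M) \<longlongrightarrow>
      0 + (\<integral>x. X x * (g x * \<phi> x) \<partial>D.M)) (at_right 0)"
      by (rule Lim_transform_eventually)
    moreover have "(\<integral>x. X x * (g x * \<phi> x) \<partial>D.M) = (\<integral>x. v x * \<phi> x \<partial>D.M)"
      by (intro Bochner_Integration.integral_cong) (auto simp: v_\<Omega> mult.assoc)
    ultimately show "((\<lambda>\<epsilon>. \<integral>x. zero_ext (\<Omega>e \<epsilon>) (u \<epsilon>) x * \<phi> x \<partial>D.M) \<longlongrightarrow> (\<integral>x. v x * \<phi> x \<partial>D.M)) (at_right 0)"
      by simp
  qed

  \<comment> \<open>On \<open>\<Omega>\<close> one has \<open>nonlocal_op J v x = w x - v x\<close>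
    and \<open>v x = X x * (w x - f x)\<close>. Hence the right-hand side is
    \<open>X x * w x - v x\<close>, which equals \<open>X x * f x\<close>.\<close>
  moreover have "AE x in D.M. X x * f x = X x * nonlocal_op J v x - (1 - X x) * v x"
  proof (rule AE_I2)
    fix x assume "x \<in> space D.M"
    then have "x \<in> \<Omega>"
      by simp
    have "v \<in> borel_measurable lebesgue"
      unfolding v_def using L2_Xg sets_\<Omega>
      by (subst borel_measurable_restrict_space_iff[symmetric]) (auto simp: L2_def)
    moreover have "integrable D.M v"
      using L2_v by (auto simp: L2_def intro: M.square_integrable_imp_integrable)
    moreover have "AE y in lebesgue. y \<notin> \<Omega> \<longrightarrow> v y = 0"
      by (simp add: v_def)
    ultimately have "nonlocal_op J v x = D.conv v x - v x"
      unfolding nonlocal_op_def by (rule D.nonlocal_integral_eq)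
    also have "D.conv v x = D.conv (\<lambda>y. X y * g y) x"
      by (intro Bochner_Integration.integral_cong) (auto simp: v_\<Omega>)
    also have "\<dots> = w x"
      unfolding g_def by (rule w(3)[symmetric])
    finally have op_eq: "nonlocal_op J v x = w x - v x" .
    show "X x * f x = X x * nonlocal_op J v x - (1 - X x) * v x"
      unfolding op_eq v_\<Omega>[OF \<open>x \<in> \<Omega>\<close>] by (simp add: g_def algebra_simps)
  qed
  ultimately show ?thesis
    using L2_v by (intro exI[of _ v]) (simp add: v_def)
qed

end
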